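(* Let $\mathcal{H}$ be a complex separable Hilbert space, and let $T_1, T_2$ be densely defined, closed linear operators in $\mathcal{H}$ such that $0 \in \widehat{\rho}(T_j)$ for $j=1,2$. (i) Assume in addition that $\operatorname{def}(T_j,0) < \infty$ for $j=1,2$. Then $T_1T_2$ and $T_2T_1$ are densely defined and closed; $T_1$, $T_2$, $T_1T_2$, $T_2T_1$ are Fredholm; $0 \in \widehat{\rho}(T_1T_2) \cap \widehat{\rho}(T_2T_1)$; and $$\operatorname{def}(T_1T_2,0) = \operatorname{def}(T_1,0) + \operatorname{def}(T_2,0) = \operatorname{def}(T_2T_1,0) \in \mathbb{N}_0.$$ (ii) Assume (in place of the additional assumption in (i)) that $T_1T_2$ is densely defined. Then $T_1T_2$ is closed; $T_1$, $T_2$, $T_1T_2$ are left semi-Fredholm; $0 \in \widehat{\rho}(T_1T_2)$; and $$\operatorname{def}(T_1T_2,0) = \operatorname{def}(T_1,0) + \operatorname{def}(T_2,0) \in \mathbb{N}_0 \cup \{\infty\}.$$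
   Context: Operators may be unbounded. $\operatorname{dom}$, $\operatorname{ran}$, $\ker$ denote domain, range, kernel. The product has its natural domain $\operatorname{dom}(T_2T_1) = \{g \in \operatorname{dom}(T_1) \mid T_1 g \in \operatorname{dom}(T_2)\}$. For a linear operator $T$ in $\mathcal{H}$, the field of regularity $\widehat{\rho}(T)$ is the set of $z \in \mathbb{C}$ for which there is $c \in (0,\infty)$ with $\|(T - zI)f\| \geq c\|f\|$ for all $f \in \operatorname{dom}(T)$. For $z \in \widehat{\rho}(T)$ the defect number is $\operatorname{def}(T,z) = \dim\big((\operatorname{ran}(T - zI))^{\perp}\big)$; for densely defined $T$, $\operatorname{def}(T,0) = \dim(\ker(T^* ))$. All infinite dimensions are denoted by $\infty$. A densely defined, closed operator $T$ with closed range is called Fredholm if $\dim(\ker(T)) + \dim(\ker(T^* )) < \infty$, and left semi-Fredholm if $\dim(\ker(T)) < \infty$. $\mathbb{N}_0 = \{0,1,2,\dots\}$. *)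

theory Defs
  imports "HOL-Analysis.Analysis" "HOL-Library.Extended_Nat"
begin

section \<open>Complex Hilbert spaces\<close>

text \<open>
  The inner product is antilinear in the first and linear in the second argument. The real scalar
  multiplication, norm, metric and topology are those of the library classes; completeness
  comes from \<^class>\<open>banach\<close>. Since the norm is nonnegative and definite, the last axiom makes the
  inner product positive definite and the norm the induced one.
\<close>

class complex_hilbert_space = banach +
  fixes scaleC :: "complex \<Rightarrow> 'a \<Rightarrow> 'a"  (infixr \<open>*\<^sub>C\<close> 75)
    and cinner :: "'a \<Rightarrow> 'a \<Rightarrow> complex"
  assumes scaleR_scaleC: "r *\<^sub>R x = complex_of_real r *\<^sub>C x"
    and scaleC_add_right: "a *\<^sub>C (x + y) = a *\<^sub>C x + a *\<^sub>C y"
    and scaleC_add_left: "(a + b) *\<^sub>C x = a *\<^sub>C x + b *\<^sub>C x"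
    and scaleC_scaleC: "a *\<^sub>C (b *\<^sub>C x) = (a * b) *\<^sub>C x"
    and scaleC_one: "1 *\<^sub>C x = x"
    and cinner_commute: "cinner x y = cnj (cinner y x)"
    and cinner_add_right: "cinner x (y + z) = cinner x y + cinner x z"
    and cinner_scaleC_right: "cinner x (a *\<^sub>C y) = a * cinner x y"
    and cinner_self: "cinner x x = complex_of_real ((norm x)\<^sup>2)"

global_interpretation complex_vector:
  vector_space "scaleC :: complex \<Rightarrow> 'a \<Rightarrow> 'a::complex_hilbert_space"
  by unfold_locales
    (simp_all add: scaleC_add_right scaleC_add_left scaleC_scaleC scaleC_one)

definition orthogonal_complement :: "'a::complex_hilbert_space set \<Rightarrow> 'a set" where
  "orthogonal_complement S = {g. \<forall>f\<in>S. cinner f g = 0}"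

text \<open>
  The dimension over the complex numbers, with a single value \<open>\<infinity>\<close> for all infinite dimensions.
  On closed subspaces it does not matter whether algebraic or Hilbert space bases are
  counted: one is finite iff the other is, and then they have the same cardinality.
\<close>

definition cdimension :: "'a::complex_hilbert_space set \<Rightarrow> enat" where
  "cdimension V =
    (if \<exists>B. finite B \<and> V \<subseteq> complex_vector.span B then enat (complex_vector.dim V) else \<infinity>)"


section \<open>Unbounded operators\<close>

text \<open>
  An operator in a Hilbert space is a partial function \<open>T :: 'a \<rightharpoonup> 'a\<close>: its domain is \<open>dom T\<close>,
  its range is \<open>ran T\<close>, its value at \<open>f \<in> dom T\<close> is \<open>the (T f)\<close>. The library composition
  \<open>S \<circ>\<^sub>m T\<close> is the operator product \<open>S T\<close> with its natural domain
  \<open>{f \<in> dom T. the (T f) \<in> dom S}\<close>.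
\<close>

definition linear_operator :: "('a::complex_hilbert_space \<rightharpoonup> 'a) \<Rightarrow> bool" where
  "linear_operator T \<longleftrightarrow> complex_vector.subspace (dom T) \<and>
    (\<forall>f\<in>dom T. \<forall>g\<in>dom T. the (T (f + g)) = the (T f) + the (T g)) \<and>
    (\<forall>c. \<forall>f\<in>dom T. the (T (c *\<^sub>C f)) = c *\<^sub>C the (T f))"

definition densely_defined :: "('a::complex_hilbert_space \<rightharpoonup> 'a) \<Rightarrow> bool" where
  "densely_defined T \<longleftrightarrow> closure (dom T) = UNIV"

definition closed_operator :: "('a::complex_hilbert_space \<rightharpoonup> 'a) \<Rightarrow> bool" where
  "closed_operator T \<longleftrightarrow> closed (Map.graph T)"

definition ker :: "('a::complex_hilbert_space \<rightharpoonup> 'a) \<Rightarrow> 'a set" where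
  "ker T = {f \<in> dom T. the (T f) = 0}"

text \<open>
  \<open>T - zI\<close>, with domain \<open>dom T\<close>.
\<close>

definition shift :: "('a::complex_hilbert_space \<rightharpoonup> 'a) \<Rightarrow> complex \<Rightarrow> ('a \<rightharpoonup> 'a)" where
  "shift T z = (\<lambda>f. map_option (\<lambda>g. g - z *\<^sub>C f) (T f))"

text \<open>
  The adjoint is meaningful for densely defined \<open>T\<close> only; the vector \<open>h\<close> below is then unique.
\<close>

definition adjoint_operator :: "('a::complex_hilbert_space \<rightharpoonup> 'a) \<Rightarrow> ('a \<rightharpoonup> 'a)" where
  "adjoint_operator T = (\<lambda>g.
    if \<exists>h. \<forall>f\<in>dom T. cinner g (the (T f)) = cinner h f
    then Some (THE h. \<forall>f\<in>dom T. cinner g (the (T f)) = cinner h f)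
    else None)"

definition field_of_regularity :: "('a::complex_hilbert_space \<rightharpoonup> 'a) \<Rightarrow> complex set" where
  "field_of_regularity T =
    {z. \<exists>c>0. \<forall>f\<in>dom T. norm (the (shift T z f)) \<ge> c * norm f}"

definition defect_number :: "('a::complex_hilbert_space \<rightharpoonup> 'a) \<Rightarrow> complex \<Rightarrow> enat" where
  "defect_number T z = cdimension (orthogonal_complement (ran (shift T z)))"

definition fredholm :: "('a::complex_hilbert_space \<rightharpoonup> 'a) \<Rightarrow> bool" where
  "fredholm T \<longleftrightarrow> linear_operator T \<and> densely_defined T \<and> closed_operator T \<and> closed (ran T) \<and>
    cdimension (ker T) + cdimension (ker (adjoint_operator T)) < \<infinity>"

definition left_semi_fredholm :: "('a::complex_hilbert_space \<rightharpoonup> 'a) \<Rightarrow> bool" where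
  "left_semi_fredholm T \<longleftrightarrow>
    linear_operator T \<and> densely_defined T \<and> closed_operator T \<and> closed (ran T) \<and>
    cdimension (ker T) < \<infinity>"

end

theory Submission
  imports Defs
begin

text \<open>
  An operator that is closed and bounded below is injective, and preimages of convergent sequences
  converge, so its range is closed and its inverse is bounded. Both properties pass to products:
  if \<open>A B f\<^sub>n\<close> converges, then so does \<open>B f\<^sub>n\<close>, then so does \<open>f\<^sub>n\<close>.

  For the defect of \<open>A B\<close>, split the complement of \<open>ran (A B)\<close> into the complement of \<open>ran A\<close> and
  the part \<open>W\<close> of it inside \<open>ran A\<close>. Applying the inverse of \<open>A\<close> and then the orthogonal
  projection onto the complement of \<open>ran B\<close> maps \<open>W\<close> injectively onto the projection of \<open>dom A\<close>.
  That image is dense in the complement of \<open>ran B\<close>, because \<open>dom A\<close> is dense in the whole space.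
  A dense subspace has the same dimension in \<open>{0, 1, 2, \<dots>, \<infinity>}\<close>, because finite-dimensional
  subspaces are closed. Hence \<open>W\<close> contributes exactly the defect of \<open>B\<close>, finite or not
  (\<open>cdimension_ran_diff_comp\<close>, \<open>defect_number_comp\<close>).

  For the density of \<open>dom (A B)\<close>, let \<open>ran B\<close> have finite codimension. A dense subspace such as
  \<open>dom A\<close> then meets \<open>ran B\<close> in a dense part of it, since this holds for each of the finitely many
  hyperplanes that cut out \<open>ran B\<close> one after the other. The bounded inverse of \<open>B\<close> carries that
  part to \<open>dom (A B)\<close>, which is therefore dense in \<open>dom B\<close> (\<open>dense_Int_finite_codimension\<close>,
  \<open>densely_defined_comp\<close>).
\<close>

section \<open>The inner product and its norm\<close>

lemma cinner_zero_right [simp]: "cinner x 0 = 0"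
  using cinner_scaleC_right[of x 0 0] by simp

lemma cinner_minus_right [simp]: "cinner x (- y) = - cinner x y"
  using cinner_add_right[of x y "- y"] by (simp add: eq_neg_iff_add_eq_0 add.commute)

lemma cinner_diff_right: "cinner x (y - z) = cinner x y - cinner x z"
  using cinner_add_right[of x y "- z"] by simp

lemma cinner_add_left: "cinner (x + y) z = cinner x z + cinner y z"
  by (simp only: cinner_commute[of _ z] cinner_add_right complex_cnj_add)

lemma cinner_diff_left: "cinner (x - y) z = cinner x z - cinner y z"
  by (simp only: cinner_commute[of _ z] cinner_diff_right complex_cnj_diff)

lemma cinner_scaleC_left: "cinner (a *\<^sub>C x) y = cnj a * cinner x y"
  by (simp only: cinner_commute[of _ y] cinner_scaleC_right complex_cnj_mult)

lemma cinner_zero_left [simp]: "cinner 0 x = 0"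
  by (simp only: cinner_commute[of 0 x] cinner_zero_right complex_cnj_zero)

lemma cinner_eq_zero_commute: "cinner x y = 0 \<longleftrightarrow> cinner y x = 0"
  by (subst cinner_commute) simp

lemma cinner_self_eq_zero [simp]: "cinner x x = 0 \<longleftrightarrow> x = 0"
  by (simp add: cinner_self)

lemma norm_sq_eq_Re_cinner: "(norm x)\<^sup>2 = Re (cinner x x)"
  by (simp add: cinner_self)

lemma norm_scaleC: "norm (a *\<^sub>C x) = cmod a * norm x"
proof -
  have "(norm (a *\<^sub>C x))\<^sup>2 = Re (cnj a * a * cinner x x)"
    by (simp add: norm_sq_eq_Re_cinner cinner_scaleC_left cinner_scaleC_right mult_ac)
  also have "cnj a * a = complex_of_real ((cmod a)\<^sup>2)"
    by (simp only: complex_norm_square mult.commute)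
  also have "Re (\<dots> * cinner x x) = (cmod a * norm x)\<^sup>2"
    by (simp add: cinner_self power_mult_distrib del: of_real_power)
  finally show ?thesis
    by (simp add: power2_eq_iff_nonneg)
qed

lemma parallelogram_law:
  fixes x y :: "'a::complex_hilbert_space"
  shows "(norm (x + y))\<^sup>2 + (norm (x - y))\<^sup>2 = 2 * (norm x)\<^sup>2 + 2 * (norm y)\<^sup>2"
  by (simp add: norm_sq_eq_Re_cinner cinner_add_left cinner_add_right cinner_diff_left
      cinner_diff_right)

lemma norm_le_norm_add_orthogonal:
  assumes "cinner p r = 0"
  shows "norm p \<le> norm (p + r)"
proof (rule power2_le_imp_le)
  have "cinner r p = 0" using assms cinner_eq_zero_commute by blast
  then have "(norm (p + r))\<^sup>2 = (norm p)\<^sup>2 + (norm r)\<^sup>2"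
    using assms by (simp add: norm_sq_eq_Re_cinner cinner_add_left cinner_add_right)
  then show "(norm p)\<^sup>2 \<le> (norm (p + r))\<^sup>2" by simp
qed simp

text \<open>
  Removing from \<open>x\<close> its component along \<open>u\<close> strictly shortens it unless \<open>x\<close> is orthogonal to \<open>u\<close>.
  The Cauchy--Schwarz inequality and the orthogonality of shortest connections both follow.
\<close>

lemma norm_sq_diff_projection:
  assumes "u \<noteq> 0"
  shows "(norm (x - (cinner u x / cinner u u) *\<^sub>C u))\<^sup>2
           = (norm x)\<^sup>2 - (cmod (cinner u x) / norm u)\<^sup>2"
proof -
  define a where "a = cinner u x"
  define r where "r = (norm u)\<^sup>2"
  have r: "cinner u u = complex_of_real r" "r \<noteq> 0"
    using assms by (simp_all add: cinner_self r_def)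
  have xu: "cinner x u = cnj a"
    unfolding a_def by (rule cinner_commute)
  have "cinner (x - (a / r) *\<^sub>C u) (x - (a / r) *\<^sub>C u)
      = cinner x x - a * cnj a / r"
    using r by (simp add: cinner_diff_left cinner_diff_right cinner_scaleC_left
        cinner_scaleC_right xu flip: a_def)
  also have "\<dots> = complex_of_real ((norm x)\<^sup>2 - (cmod a)\<^sup>2 / r)"
    by (simp add: cinner_self flip: complex_norm_square)
  finally show ?thesis
    unfolding norm_sq_eq_Re_cinner[of "x - _"] r(1) a_def[symmetric]
    by (simp add: power_divide r_def)
qed

lemma cauchy_schwarz: "cmod (cinner u x) \<le> norm u * norm x"
proof (cases "u = 0")
  case False
  have "0 \<le> (norm x)\<^sup>2 - (cmod (cinner u x) / norm u)\<^sup>2"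
    unfolding norm_sq_diff_projection[OF False, symmetric] by simp
  then have "cmod (cinner u x) / norm u \<le> norm x"
    by (intro power2_le_imp_le[OF _ norm_ge_zero]) simp
  with False show ?thesis
    by (simp add: divide_le_eq mult.commute)
qed simp

lemma bounded_linear_cinner: "bounded_linear (cinner u)"
proof (rule bounded_linear_intro[of _ "norm u"])
  show "cinner u (r *\<^sub>R x) = r *\<^sub>R cinner u x" for r x
    by (simp add: scaleR_scaleC cinner_scaleC_right scaleR_conv_of_real)
  show "norm (cinner u x) \<le> norm x * norm u" for x
    using cauchy_schwarz[of u x] by (simp add: mult.commute)
qed (rule cinner_add_right)

lemma bounded_linear_scaleC_left: "bounded_linear (\<lambda>a. a *\<^sub>C (x::'a::complex_hilbert_space))"
proof (rule bounded_linear_intro[of _ "norm x"])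
  show "(r *\<^sub>R a) *\<^sub>C x = r *\<^sub>R (a *\<^sub>C x)" for r a
    by (simp only: scaleR_scaleC scaleC_scaleC scaleR_conv_of_real)
qed (simp_all add: scaleC_add_left norm_scaleC)


section \<open>Orthogonal decomposition\<close>

lemma orthogonal_complementI: "(\<And>f. f \<in> S \<Longrightarrow> cinner f g = 0) \<Longrightarrow> g \<in> orthogonal_complement S"
  by (simp add: orthogonal_complement_def)

lemma orthogonal_complementD:
  assumes "g \<in> orthogonal_complement S" "f \<in> S"
  shows "cinner f g = 0" "cinner g f = 0"
  using assms cinner_eq_zero_commute[of f g] by (simp_all add: orthogonal_complement_def)

lemma subspace_orthogonal_complement: "complex_vector.subspace (orthogonal_complement S)"
  by (auto simp: complex_vector.subspace_def orthogonal_complement_def cinner_add_right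
      cinner_scaleC_right)

lemma orthogonal_complement_antimono:
  "S \<subseteq> S' \<Longrightarrow> orthogonal_complement S' \<subseteq> orthogonal_complement S"
  by (auto simp: orthogonal_complement_def)

lemma closed_orthogonal_complement: "closed (orthogonal_complement S)"
proof -
  have "orthogonal_complement S = (\<Inter>f\<in>S. cinner f -` {0})"
    by (auto simp: orthogonal_complement_def)
  moreover have "closed (cinner f -` {0})" for f :: 'a
    by (rule closed_vimage) (auto intro: linear_continuous_on bounded_linear_cinner)
  ultimately show ?thesis by (simp add: closed_INT)
qed

lemma orthogonal_to_self_imp_zero:
  "x \<in> S \<Longrightarrow> x \<in> orthogonal_complement S \<Longrightarrow> x = 0"
  using orthogonal_complementD(1)[of x S x] by simp

lemma Int_orthogonal_complement:
  assumes "complex_vector.subspace N"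
  shows "N \<inter> orthogonal_complement N = {0}"
  using complex_vector.subspace_0[OF assms] orthogonal_to_self_imp_zero
    complex_vector.subspace_0[OF subspace_orthogonal_complement] by blast

lemma subset_orthogonal_complement_twice: "S \<subseteq> orthogonal_complement (orthogonal_complement S)"
  unfolding orthogonal_complement_def using cinner_eq_zero_commute by blast

lemma orthogonal_complement_closure:
  "orthogonal_complement (closure S) = orthogonal_complement S"
proof
  have "S \<subseteq> orthogonal_complement (orthogonal_complement S)"
    by (rule subset_orthogonal_complement_twice)
  then have "closure S \<subseteq> orthogonal_complement (orthogonal_complement S)"
    by (intro closure_minimal closed_orthogonal_complement)
  then show "orthogonal_complement S \<subseteq> orthogonal_complement (closure S)"
    unfolding orthogonal_complement_def using cinner_eq_zero_commute by blast
qed (intro orthogonal_complement_antimono closure_subset)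

lemma orthogonal_complement_span:
  "orthogonal_complement (complex_vector.span S) = orthogonal_complement S"
proof
  have "complex_vector.span S \<subseteq> orthogonal_complement (orthogonal_complement S)"
    by (intro complex_vector.span_minimal subset_orthogonal_complement_twice
        subspace_orthogonal_complement)
  then show "orthogonal_complement S \<subseteq> orthogonal_complement (complex_vector.span S)"
    unfolding orthogonal_complement_def using cinner_eq_zero_commute by blast
qed (intro orthogonal_complement_antimono complex_vector.span_superset)

text \<open>
  Closed subspaces and spans of finite sets are both of this kind; for the latter this is how their
  closedness is obtained.
\<close>

definition has_projections :: "'a::complex_hilbert_space set \<Rightarrow> bool" where
  "has_projections N \<longleftrightarrow> complex_vector.subspace N \<and>
     (\<forall>x. \<exists>y\<in>N. x - y \<in> orthogonal_complement N)"

lemma has_projections_imp_double_complement: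
  assumes "has_projections N"
  shows "orthogonal_complement (orthogonal_complement N) = N"
proof
  show "orthogonal_complement (orthogonal_complement N) \<subseteq> N"
  proof
    fix x assume x: "x \<in> orthogonal_complement (orthogonal_complement N)"
    obtain y where y: "y \<in> N" "x - y \<in> orthogonal_complement N"
      using assms unfolding has_projections_def by blast
    have "x - y \<in> orthogonal_complement (orthogonal_complement N)"
      using x y(1) subset_orthogonal_complement_twice
      by (blast intro: complex_vector.subspace_diff[OF subspace_orthogonal_complement])
    then have "x - y = 0"
      by (rule orthogonal_to_self_imp_zero[OF y(2)])
    with y(1) show "x \<in> N" by simp
  qed
qed (rule subset_orthogonal_complement_twice)

lemma has_projections_imp_closed: "has_projections N \<Longrightarrow> closed N"
  using closed_orthogonal_complement has_projections_imp_double_complement by metis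

text \<open>
  If \<open>x - y\<close> had a component along some \<open>v \<in> N\<close>, then moving \<open>y\<close> within \<open>N\<close> by that component would
  bring it closer to \<open>x\<close>.
\<close>

lemma nearest_imp_orthogonal:
  assumes N: "complex_vector.subspace N" "y \<in> N"
    and nearest: "\<And>v. v \<in> N \<Longrightarrow> norm (x - y) \<le> norm (x - v)"
  shows "x - y \<in> orthogonal_complement N"
proof (rule orthogonal_complementI, rule ccontr)
  fix v assume v: "v \<in> N" "cinner v (x - y) \<noteq> 0"
  define c where "c = cinner v (x - y) / cinner v v"
  have "v \<noteq> 0" using v by auto
  then have "(norm (x - y - c *\<^sub>C v))\<^sup>2 < (norm (x - y))\<^sup>2"
    unfolding c_def norm_sq_diff_projection[OF \<open>v \<noteq> 0\<close>] using v by simp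
  moreover have "norm (x - y) \<le> norm (x - (y + c *\<^sub>C v))"
    using N v by (intro nearest complex_vector.subspace_add complex_vector.subspace_scale)
  ultimately show False
    using power2_less_imp_less[OF _ norm_ge_zero] by (force simp: diff_diff_eq)
qed

text \<open>
  The projection theorem: the parallelogram law makes every minimizing sequence for the distance
  to \<open>N\<close> a Cauchy sequence, so that completeness yields a nearest point.
\<close>

lemma closed_subspace_has_projections:
  assumes N: "complex_vector.subspace N" "closed N"
  shows "has_projections N"
  unfolding has_projections_def
proof (intro conjI allI N(1))
  fix x :: 'a
  define D where "D = (INF v\<in>N. (norm (x - v))\<^sup>2)"
  have ne: "N \<noteq> {}" using complex_vector.subspace_0[OF N(1)] by auto
  have bdd: "bdd_below ((\<lambda>v. (norm (x - v))\<^sup>2) ` N)"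
    by (rule bdd_belowI[of _ 0]) auto
  have D_le: "D \<le> (norm (x - v))\<^sup>2" if "v \<in> N" for v
    unfolding D_def by (rule cINF_lower[OF bdd that])
  have "\<exists>v\<in>N. (norm (x - v))\<^sup>2 < D + inverse (real (Suc n))" for n
    using cINF_less_iff[OF ne bdd, of "D + inverse (real (Suc n))"] unfolding D_def by simp
  then obtain v where v: "\<And>n. v n \<in> N"
    and v_lt: "\<And>n. (norm (x - v n))\<^sup>2 < D + inverse (real (Suc n))"
    by metis
  have dist: "(norm (v m - v n))\<^sup>2 \<le> 2 * inverse (real (Suc m)) + 2 * inverse (real (Suc n))"
    for m n
  proof -
    \<comment> \<open>The midpoint of \<open>v m\<close> and \<open>v n\<close> lies in \<open>N\<close>, so it is not closer to \<open>x\<close> than the infimum.\<close>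
    define z where "z = (1/2) *\<^sub>C (v m + v n)"
    have "z \<in> N"
      unfolding z_def using v N(1)
      by (intro complex_vector.subspace_scale complex_vector.subspace_add)
    then have "D \<le> (norm (x - z))\<^sup>2" by (rule D_le)
    moreover have "(x - v n) + (x - v m) = 2 *\<^sub>C (x - z)"
      using scaleC_add_left[of 1 1 x]
      by (simp add: z_def complex_vector.scale_right_diff_distrib scaleC_scaleC scaleC_one)
    then have "norm ((x - v n) + (x - v m)) = 2 * norm (x - z)"
      by (simp add: norm_scaleC)
    ultimately show ?thesis
      using parallelogram_law[of "x - v n" "x - v m"] v_lt[of m] v_lt[of n]
      by (simp add: power_mult_distrib)
  qed
  have "Cauchy v"
  proof (rule metric_CauchyI)
    fix e :: real assume e: "0 < e"
    obtain M where M: "inverse (real (Suc M)) < e\<^sup>2 / 4"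
      using reals_Archimedean[of "e\<^sup>2 / 4"] e by auto
    have "dist (v m) (v n) < e" if "m \<ge> M" "n \<ge> M" for m n
    proof -
      have "inverse (real (Suc m)) \<le> inverse (real (Suc M))"
        "inverse (real (Suc n)) \<le> inverse (real (Suc M))"
        using that by (simp_all add: le_imp_inverse_le)
      then have "(norm (v m - v n))\<^sup>2 < e\<^sup>2"
        using dist[of m n] M by linarith
      then show ?thesis
        unfolding dist_norm by (rule power2_less_imp_less) (use e in simp)
    qed
    then show "\<exists>M. \<forall>m\<ge>M. \<forall>n\<ge>M. dist (v m) (v n) < e" by blast
  qed
  then obtain y where y: "v \<longlonglongrightarrow> y"
    using Cauchy_convergent convergent_def by blast
  have "y \<in> N" using closed_sequentially[OF N(2)] v y by blast
  moreover have "norm (x - y) \<le> norm (x - w)" if "w \<in> N" for w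
  proof (rule power2_le_imp_le)
    have "(\<lambda>n. (norm (x - v n))\<^sup>2) \<longlonglongrightarrow> (norm (x - y))\<^sup>2"
      by (intro tendsto_intros y)
    moreover have "(\<lambda>n. D + inverse (real (Suc n))) \<longlonglongrightarrow> D + 0"
      by (intro tendsto_intros LIMSEQ_inverse_real_of_nat)
    ultimately have "(norm (x - y))\<^sup>2 \<le> D + 0"
      by (rule LIMSEQ_le) (use v_lt less_imp_le in blast)
    then show "(norm (x - y))\<^sup>2 \<le> (norm (x - w))\<^sup>2"
      using D_le[OF that] by linarith
  qed simp
  ultimately show "\<exists>y\<in>N. x - y \<in> orthogonal_complement N"
    using nearest_imp_orthogonal[OF N(1)] by blast
qed

text \<open>
  One Gram--Schmidt step per vector: \<open>u\<close> is replaced by its part \<open>p\<close> orthogonal to the span so far,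
  and a projection onto the larger span is the old one plus the component along \<open>p\<close>.
\<close>

lemma finite_span_has_projections:
  assumes "finite B"
  shows "has_projections (complex_vector.span B)"
  using assms
proof (induction B)
  case empty
  show ?case by (simp add: has_projections_def orthogonal_complement_def complex_vector.subspace_0)
next
  case (insert u B)
  let ?N = "complex_vector.span B"
  let ?M = "complex_vector.span (insert u B)"
  have NM: "?N \<subseteq> ?M" by (rule complex_vector.span_mono) auto
  obtain n where n: "n \<in> ?N" "u - n \<in> orthogonal_complement ?N"
    using insert.IH unfolding has_projections_def by blast
  define p where "p = u - n"
  have p: "p \<in> ?M" "p \<in> orthogonal_complement ?N"
    using n NM complex_vector.span_base[of u "insert u B"]
    by (auto simp: p_def intro: complex_vector.span_diff)
  have "\<exists>y\<in>?M. x - y \<in> orthogonal_complement ?M" for x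
  proof -
    obtain m where m: "m \<in> ?N" "x - m \<in> orthogonal_complement ?N"
      using insert.IH unfolding has_projections_def by blast
    \<comment> \<open>If \<open>u\<close> already lies in the span, then \<open>p = 0\<close> and, by the convention on division, \<open>c = 0\<close>.\<close>
    define c where "c = cinner p (x - m) / cinner p p"
    define y where "y = m + c *\<^sub>C p"
    have "y \<in> ?M"
      using m p NM by (auto simp: y_def intro!: complex_vector.span_add complex_vector.span_scale)
    have xy: "x - y = (x - m) - c *\<^sub>C p" by (simp add: y_def)
    have "x - y \<in> orthogonal_complement ?N"
      unfolding xy
      by (rule complex_vector.subspace_diff[OF subspace_orthogonal_complement m(2)
            complex_vector.subspace_scale[OF subspace_orthogonal_complement p(2)]])
    then have oN: "cinner f (x - y) = 0" if "f \<in> ?N" for f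
      using that orthogonal_complementD by blast
    have "cinner p (x - y) = 0"
      by (cases "p = 0") (simp_all add: xy c_def cinner_diff_right cinner_scaleC_right)
    then have "cinner u (x - y) = 0"
      using oN[OF n(1)] by (simp add: p_def cinner_diff_left)
    then have "x - y \<in> orthogonal_complement (insert u B)"
      using oN complex_vector.span_base by (auto intro!: orthogonal_complementI)
    then show ?thesis
      using \<open>y \<in> ?M\<close> by (auto simp: orthogonal_complement_span)
  qed
  then show ?case by (simp add: has_projections_def)
qed


section \<open>Dimension\<close>

lemma cdimension_eq_card_basis:
  assumes "complex_vector.independent B"
  shows "cdimension (complex_vector.span B) = (if finite B then enat (card B) else \<infinity>)"
proof -
  have "finite B" if "finite C" "complex_vector.span B \<subseteq> complex_vector.span C" for C
    using complex_vector.independent_span_bound[OF that(1) assms] that(2)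
      complex_vector.span_superset by blast
  then show ?thesis
    using complex_vector.dim_span_eq_card_independent[OF assms]
    by (auto simp: cdimension_def)
qed

lemma subspace_basisE:
  assumes "complex_vector.subspace V"
  obtains B where "complex_vector.independent B" "complex_vector.span B = V"
  using complex_vector.maximal_independent_subset[of V] complex_vector.span_minimal[OF _ assms]
  by (metis subset_antisym)

lemma cdimension_finite_iff:
  "cdimension V < \<infinity> \<longleftrightarrow> (\<exists>B. finite B \<and> V \<subseteq> complex_vector.span B)"
  by (auto simp: cdimension_def)

lemma cdimension_mono_finite: "V \<subseteq> W \<Longrightarrow> cdimension W < \<infinity> \<Longrightarrow> cdimension V < \<infinity>"
  unfolding cdimension_finite_iff by (meson subset_trans)

text \<open>
  A linear map that is composed of partially defined inverses is most easily given by its graph.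
\<close>

lemma linear_of_linear_relation:
  assumes total: "\<And>x. \<exists>y. R x y"
    and add: "\<And>x y x' y'. R x y \<Longrightarrow> R x' y' \<Longrightarrow> R (x + x') (y + y')"
    and scale: "\<And>c x y. R x y \<Longrightarrow> R (c *\<^sub>C x) (c *\<^sub>C y)"
    and unique: "\<And>y. R 0 y \<Longrightarrow> y = 0"
  obtains \<phi> :: "'a::complex_hilbert_space \<Rightarrow> 'b::complex_hilbert_space"
  where "Vector_Spaces.linear scaleC scaleC \<phi>" "\<And>x y. \<phi> x = y \<longleftrightarrow> R x y"
proof -
  obtain \<phi> where \<phi>: "\<And>x. R x (\<phi> x)" using total by metis
  have eq: "\<phi> x = y \<longleftrightarrow> R x y" for x y
  proof
    assume "R x y"
    from add[OF \<phi>[of x] scale[OF this, of "- 1"]] have "R 0 (\<phi> x - y)" by simp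
    from unique[OF this] show "\<phi> x = y" by simp
  next
    assume "\<phi> x = y"
    with \<phi>[of x] show "R x y" by simp
  qed
  have "Vector_Spaces.linear scaleC scaleC \<phi>"
    unfolding Vector_Spaces.linear_iff eq
    by (intro conjI allI complex_vector.vector_space_axioms add scale \<phi>)
  then show ?thesis using eq by (rule that)
qed

lemma cdimension_injective_image:
  assumes \<phi>: "Vector_Spaces.linear scaleC scaleC \<phi>"
    and V: "complex_vector.subspace V" and inj: "inj_on \<phi> V"
  shows "cdimension (\<phi> ` V) = cdimension V"
proof -
  interpret \<phi>: Vector_Spaces.linear scaleC scaleC \<phi> by (rule \<phi>)
  obtain B where B: "complex_vector.independent B" "complex_vector.span B = V"
    using subspace_basisE[OF V] by blast
  have "inj_on \<phi> B"
    using inj B complex_vector.span_superset inj_on_subset by blast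
  moreover have "complex_vector.independent (\<phi> ` B)"
    using \<phi>.independent_injective_image B inj by simp
  moreover have "\<phi> ` V = complex_vector.span (\<phi> ` B)"
    using \<phi>.span_image B by simp
  ultimately show ?thesis
    using cdimension_eq_card_basis[OF B(1)] cdimension_eq_card_basis[of "\<phi> ` B"]
    by (simp add: B(2) card_image finite_image_iff)
qed

lemma independent_Un_disjoint_span:
  assumes B: "complex_vector.independent B" and C: "complex_vector.independent C" "finite C"
    and disj: "complex_vector.span B \<inter> complex_vector.span C = {0::'a::complex_hilbert_space}"
  shows "complex_vector.independent (B \<union> C)"
  using C(2,1) disj
proof (induction C)
  case empty
  then show ?case using B by simp
next
  case (insert c C)
  have C: "complex_vector.independent C" "c \<notin> complex_vector.span C"
    using insert.prems(1) insert.hyps(2) by (simp_all add: complex_vector.independent_insert)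
  have sub: "complex_vector.span C \<subseteq> complex_vector.span (insert c C)"
    by (rule complex_vector.span_mono) auto
  then have "complex_vector.span B \<inter> complex_vector.span C = {0}"
    using insert.prems(2) complex_vector.span_zero by blast
  then have IH: "complex_vector.independent (B \<union> C)"
    using insert.IH C(1) by blast
  have "c \<notin> complex_vector.span (B \<union> C)"
  proof
    assume "c \<in> complex_vector.span (B \<union> C)"
    then obtain b w where bw: "b \<in> complex_vector.span B" "w \<in> complex_vector.span C" "c = b + w"
      by (auto simp: complex_vector.span_Un)
    then have "b = c - w" by simp
    then have "b \<in> complex_vector.span (insert c C)"
      using bw(2) sub by (auto intro: complex_vector.span_diff complex_vector.span_base)
    then have "b = 0" using bw(1) insert.prems(2) by blast
    then show False using bw C(2) by simp
  qed
  with IH show ?case by (simp add: complex_vector.independent_insertI)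
qed

text \<open>
  The union of finite bases of \<open>V\<close> and \<open>W\<close> is a basis of \<open>U\<close>, and an infinite-dimensional summand makes
  \<open>U\<close> infinite-dimensional.
\<close>

lemma cdimension_direct_sum:
  assumes V: "complex_vector.subspace V" and W: "complex_vector.subspace W"
    and U: "complex_vector.subspace U"
    and disj: "V \<inter> W = {0}" and sub: "V \<subseteq> U" "W \<subseteq> U"
    and sum: "\<And>u. u \<in> U \<Longrightarrow> \<exists>v\<in>V. \<exists>w\<in>W. u = v + w"
  shows "cdimension U = cdimension V + cdimension W"
proof -
  obtain B where B: "complex_vector.independent B" "complex_vector.span B = V"
    using subspace_basisE[OF V] by blast
  obtain C where C: "complex_vector.independent C" "complex_vector.span C = W"
    using subspace_basisE[OF W] by blast
  show ?thesis
  proof (cases "finite B \<and> finite C")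
    case True
    have "B \<inter> C \<subseteq> {0}"
      using B C disj complex_vector.span_superset by blast
    then have "B \<inter> C = {}"
      using B(1) complex_vector.dependent_zero by blast
    have BC: "complex_vector.independent (B \<union> C)"
      using True B C disj by (intro independent_Un_disjoint_span) auto
    have "U = complex_vector.span (B \<union> C)"
      unfolding complex_vector.span_Un B C
      using sum sub complex_vector.subspace_add[OF U] by fastforce
    then show ?thesis
      using True cdimension_eq_card_basis[OF BC] cdimension_eq_card_basis[OF B(1)]
        cdimension_eq_card_basis[OF C(1)] \<open>B \<inter> C = {}\<close>
      by (simp add: B C card_Un_disjoint)
  next
    case False
    then have inf: "cdimension V = \<infinity> \<or> cdimension W = \<infinity>"
      using cdimension_eq_card_basis[OF B(1)] cdimension_eq_card_basis[OF C(1)]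
      by (auto simp: B C)
    have "cdimension U = \<infinity>"
    proof (rule ccontr)
      assume "cdimension U \<noteq> \<infinity>"
      then have "cdimension V < \<infinity> \<and> cdimension W < \<infinity>"
        using sub cdimension_mono_finite by (metis enat_ord_simps(4))
      with inf show False by auto
    qed
    with inf show ?thesis by auto
  qed
qed

text \<open>
  A finite-dimensional subspace is closed, so it cannot be dense in anything larger; if \<open>W\<close> is
  infinite-dimensional, then so is \<open>V\<close>.
\<close>

lemma cdimension_dense_subspace:
  assumes W: "complex_vector.subspace W" and sub: "W \<subseteq> V" and dense: "V \<subseteq> closure W"
  shows "cdimension W = cdimension V"
proof (cases "cdimension W < \<infinity>")
  case True
  obtain B where B: "complex_vector.independent B" "complex_vector.span B = W"
    using subspace_basisE[OF W] by blast
  have "finite B"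
    using True cdimension_eq_card_basis[OF B(1)] B(2) by (auto split: if_splits)
  then have "closed W"
    using has_projections_imp_closed finite_span_has_projections B by blast
  with sub dense show ?thesis by (simp add: closure_closed)
next
  case False
  then have "\<not> cdimension V < \<infinity>"
    using sub cdimension_mono_finite by blast
  with False show ?thesis by simp
qed


section \<open>Dense subspaces and finite codimension\<close>

text \<open>
  Induction on the hyperplanes. If \<open>E = D \<inter> orthogonal_complement B\<close> is dense in the complement of \<open>B\<close>
  and \<open>cinner u\<close> does not vanish on \<open>E\<close>, then some \<open>d \<in> E\<close> has \<open>cinner u d = 1\<close>, and subtracting
  multiples of \<open>d\<close> turns an approximation from \<open>E\<close> into one from the hyperplane. If \<open>cinner u\<close>
  vanishes on \<open>E\<close>, then \<open>E\<close> already lies in the next hyperplane.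
\<close>

lemma dense_Int_orthogonal_complement_finite:
  assumes D: "complex_vector.subspace D" and dense: "closure D = UNIV" and "finite B"
  shows "orthogonal_complement B \<subseteq> closure (D \<inter> orthogonal_complement B)"
  using \<open>finite B\<close>
proof (induction B)
  case empty
  then show ?case using dense by (simp add: orthogonal_complement_def)
next
  case (insert u B)
  define E where "E = D \<inter> orthogonal_complement B"
  have E: "complex_vector.subspace E"
    unfolding E_def by (intro complex_vector.subspace_inter D subspace_orthogonal_complement)
  have eq: "orthogonal_complement (insert u B) = {x \<in> orthogonal_complement B. cinner u x = 0}"
    by (auto simp: orthogonal_complement_def)
  show ?case
  proof (cases "\<forall>d\<in>E. cinner u d = 0")
    case True
    then have "E = D \<inter> orthogonal_complement (insert u B)"
      by (auto simp: E_def eq)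
    then show ?thesis
      using insert.IH orthogonal_complement_antimono[of B "insert u B"] by (auto simp: E_def)
  next
    case False
    then obtain e where e: "e \<in> E" "cinner u e \<noteq> 0" by blast
    define d where "d = (1 / cinner u e) *\<^sub>C e"
    have d: "d \<in> E" "cinner u d = 1"
      using e by (simp_all add: d_def complex_vector.subspace_scale[OF E] cinner_scaleC_right)
    show ?thesis
    proof
      fix x assume x: "x \<in> orthogonal_complement (insert u B)"
      then have "x \<in> closure E"
        using insert.IH by (auto simp: E_def eq)
      then obtain f where f: "\<forall>n. f n \<in> E" "f \<longlonglongrightarrow> x"
        unfolding closure_sequential by blast
      \<comment> \<open>Moving along \<open>d\<close> corrects the functional \<open>cinner u\<close> without leaving \<open>E\<close>.\<close>
      define g where "g n = f n - cinner u (f n) *\<^sub>C d" for n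
      have "g n \<in> E" for n
        unfolding g_def using f(1) d(1)
        by (intro complex_vector.subspace_diff complex_vector.subspace_scale E) auto
      moreover have "cinner u (g n) = 0" for n
        by (simp add: g_def cinner_diff_right cinner_scaleC_right d(2))
      ultimately have "g n \<in> D \<inter> orthogonal_complement (insert u B)" for n
        by (auto simp: E_def eq)
      moreover have "g \<longlonglongrightarrow> x - cinner u x *\<^sub>C d"
        unfolding g_def
        by (intro tendsto_diff f(2) bounded_linear.tendsto[OF bounded_linear_scaleC_left]
            bounded_linear.tendsto[OF bounded_linear_cinner])
      moreover have "cinner u x = 0" using x by (simp add: eq)
      ultimately show "x \<in> closure (D \<inter> orthogonal_complement (insert u B))"
        unfolding closure_sequential by (intro exI[of _ g]) simp
    qed
  qed
qed

lemma dense_Int_finite_codimension: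
  assumes D: "complex_vector.subspace D" "closure D = UNIV"
    and N: "has_projections N" "cdimension (orthogonal_complement N) < \<infinity>"
  shows "N \<subseteq> closure (D \<inter> N)"
proof -
  obtain B where B: "complex_vector.independent B" "complex_vector.span B = orthogonal_complement N"
    using subspace_basisE[OF subspace_orthogonal_complement[of N]] by blast
  have "finite B"
    using N(2) cdimension_eq_card_basis[OF B(1)] by (auto simp: B split: if_splits)
  moreover have "orthogonal_complement B = N"
    using has_projections_imp_double_complement[OF N(1)] orthogonal_complement_span[of B]
    by (simp add: B)
  ultimately show ?thesis
    using dense_Int_orthogonal_complement_finite[OF D] by metis
qed


section \<open>Operators that are bounded below\<close>

lemma ran_eq_image: "ran T = (\<lambda>f. the (T f)) ` dom T"
proof
  show "ran T \<subseteq> (\<lambda>f. the (T f)) ` dom T"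
  proof
    fix y assume "y \<in> ran T"
    then obtain f where "T f = Some y" by (auto simp: ran_def)
    then show "y \<in> (\<lambda>f. the (T f)) ` dom T" by (intro image_eqI[of _ _ f]) auto
  qed
qed (auto simp: ran_def)

lemma dom_comp_eq: "dom (S \<circ>\<^sub>m T) = {f \<in> dom T. the (T f) \<in> dom S}"
  by (rule set_eqI) (simp add: map_comp_def dom_def split: option.split)

lemma the_comp_eq: "f \<in> dom T \<Longrightarrow> the ((S \<circ>\<^sub>m T) f) = the (S (the (T f)))"
  by (clarsimp simp: map_comp_def dom_def)

lemma ran_comp_subset: "ran (S \<circ>\<^sub>m T) \<subseteq> ran S"
  unfolding ran_def map_comp_Some_iff by blast

lemma shift_zero: "shift T 0 = T"
  by (rule ext) (simp add: shift_def option.map_ident)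

lemma zero_in_field_of_regularity_iff:
  "0 \<in> field_of_regularity T \<longleftrightarrow> (\<exists>c>0. \<forall>f\<in>dom T. norm (the (T f)) \<ge> c * norm f)"
  by (simp add: field_of_regularity_def shift_zero)

lemma defect_number_zero: "defect_number T 0 = cdimension (orthogonal_complement (ran T))"
  by (simp add: defect_number_def shift_zero)

text \<open>
  Density of the domain determines the value of the adjoint, so a vector orthogonal to the range has
  the value \<open>0\<close>.
\<close>

lemma ker_adjoint_operator:
  assumes "densely_defined T"
  shows "ker (adjoint_operator T) = orthogonal_complement (ran T)"
proof -
  have unique: "h = k" if "\<forall>f\<in>dom T. cinner h f = cinner k f" for h k
  proof -
    have "h - k \<in> orthogonal_complement (dom T)"
      using that by (auto intro!: orthogonal_complementI
          simp: cinner_eq_zero_commute[of _ "h - k"] cinner_diff_left)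
    then have "h - k \<in> orthogonal_complement UNIV"
      using assms orthogonal_complement_closure[of "dom T"] by (simp add: densely_defined_def)
    then show ?thesis
      using orthogonal_complementD(1)[of "h - k" UNIV "h - k"] by simp
  qed
  have the_eq: "(THE h. \<forall>f\<in>dom T. cinner g (the (T f)) = cinner h f) = h"
    if "\<forall>f\<in>dom T. cinner g (the (T f)) = cinner h f" for g h
    by (rule the_equality) (use that unique in auto)
  have "g \<in> ker (adjoint_operator T) \<longleftrightarrow> (\<forall>f\<in>dom T. cinner g (the (T f)) = cinner 0 f)" for g
  proof
    assume g: "g \<in> ker (adjoint_operator T)"
    then obtain h where h: "\<forall>f\<in>dom T. cinner g (the (T f)) = cinner h f"
      by (auto simp: ker_def adjoint_operator_def split: if_splits)
    then have "adjoint_operator T g = Some h"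
      using the_eq[OF h] by (auto simp: adjoint_operator_def)
    with g have "h = 0" by (simp add: ker_def)
    with h show "\<forall>f\<in>dom T. cinner g (the (T f)) = cinner 0 f" by simp
  next
    assume h: "\<forall>f\<in>dom T. cinner g (the (T f)) = cinner 0 f"
    then have "adjoint_operator T g = Some 0"
      using the_eq[OF h] unfolding adjoint_operator_def by metis
    then show "g \<in> ker (adjoint_operator T)" by (auto simp: ker_def)
  qed
  then show ?thesis
    by (simp add: set_eq_iff orthogonal_complement_def ran_eq_image cinner_eq_zero_commute[of g for g])
qed

text \<open>
  The hypotheses shared by \<open>T\<^sub>1\<close> and \<open>T\<^sub>2\<close>. The product of two such operators is
  again one, whereas density of the domain need not be inherited by products.
\<close>

locale regular_operator =
  fixes T :: "'a::complex_hilbert_space \<rightharpoonup> 'a"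
  assumes linear: "linear_operator T"
    and closed: "closed_operator T"
    and regular: "0 \<in> field_of_regularity T"
begin

lemma subspace_dom: "complex_vector.subspace (dom T)"
  using linear by (simp add: linear_operator_def)

lemma apply_add: "f \<in> dom T \<Longrightarrow> g \<in> dom T \<Longrightarrow> the (T (f + g)) = the (T f) + the (T g)"
  using linear by (simp add: linear_operator_def)

lemma apply_scale: "f \<in> dom T \<Longrightarrow> the (T (c *\<^sub>C f)) = c *\<^sub>C the (T f)"
  using linear by (simp add: linear_operator_def)

lemma apply_diff:
  assumes "f \<in> dom T" "g \<in> dom T"
  shows "the (T (f - g)) = the (T f) - the (T g)"
  using apply_add[of "f - g" g] complex_vector.subspace_diff[OF subspace_dom assms] assms
  by (simp add: algebra_simps)

lemma apply_zero: "the (T 0) = 0"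
  using apply_diff[of 0 0] complex_vector.subspace_0[OF subspace_dom] by simp

lemma apply_in_ran: "f \<in> dom T \<Longrightarrow> the (T f) \<in> ran T"
  by (auto simp: ran_eq_image)

lemma subspace_ran: "complex_vector.subspace (ran T)"
proof -
  have D: "0 \<in> dom T" "\<And>f g. f \<in> dom T \<Longrightarrow> g \<in> dom T \<Longrightarrow> f + g \<in> dom T"
    "\<And>c f. f \<in> dom T \<Longrightarrow> c *\<^sub>C f \<in> dom T"
    using subspace_dom unfolding complex_vector.subspace_def by blast+
  show ?thesis
    unfolding complex_vector.subspace_def
  proof (intro conjI ballI allI)
    show "0 \<in> ran T" using apply_in_ran[OF D(1)] by (simp only: apply_zero)
    fix y assume "y \<in> ran T"
    then obtain f where f: "f \<in> dom T" "y = the (T f)"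
      unfolding ran_eq_image by blast
    show "y + z \<in> ran T" if "z \<in> ran T" for z
    proof -
      obtain g where g: "g \<in> dom T" "z = the (T g)"
        using \<open>z \<in> ran T\<close> unfolding ran_eq_image by blast
      show ?thesis
        using apply_in_ran[OF D(2)[OF f(1) g(1)]] by (simp only: apply_add[OF f(1) g(1)] f(2) g(2))
    qed
    show "c *\<^sub>C y \<in> ran T" for c
      using apply_in_ran[OF D(3)[OF f(1)]] by (simp only: apply_scale[OF f(1)] f(2))
  qed
qed

lemma lower_bound:
  obtains c where "c > 0" "\<And>f. f \<in> dom T \<Longrightarrow> c * norm f \<le> norm (the (T f))"
  using regular by (auto simp: zero_in_field_of_regularity_iff)

lemma ker_trivial: "ker T = {0}"
proof -
  obtain c where "c > 0" "\<And>f. f \<in> dom T \<Longrightarrow> c * norm f \<le> norm (the (T f))"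
    using lower_bound by blast
  then have "f = 0" if "f \<in> ker T" for f
    using that by (fastforce simp: ker_def mult_le_0_iff)
  moreover have "0 \<in> ker T"
    using apply_zero complex_vector.subspace_0[OF subspace_dom] by (simp add: ker_def)
  ultimately show ?thesis by blast
qed

text \<open>
  The lower bound makes the preimages a Cauchy sequence, and closedness identifies their limit.
\<close>

lemma preimages_converge:
  assumes f: "\<And>n. f n \<in> dom T" and lim: "(\<lambda>n. the (T (f n))) \<longlonglongrightarrow> y"
  obtains g where "f \<longlonglongrightarrow> g" "T g = Some y"
proof -
  obtain c where c: "c > 0" "\<And>f. f \<in> dom T \<Longrightarrow> c * norm f \<le> norm (the (T f))"
    using lower_bound by blast
  have "Cauchy f"
  proof (rule metric_CauchyI)
    fix e :: real assume e: "0 < e"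
    have "Cauchy (\<lambda>n. the (T (f n)))"
      using lim LIMSEQ_imp_Cauchy by blast
    then obtain M where M: "\<And>m n. m \<ge> M \<Longrightarrow> n \<ge> M \<Longrightarrow> dist (the (T (f m))) (the (T (f n))) < c * e"
      using metric_CauchyD[of _ "c * e"] c(1) e by (metis mult_pos_pos)
    have "dist (f m) (f n) < e" if "m \<ge> M" "n \<ge> M" for m n
    proof -
      have "c * norm (f m - f n) \<le> norm (the (T (f m)) - the (T (f n)))"
        using c(2)[of "f m - f n"] f complex_vector.subspace_diff[OF subspace_dom]
        by (simp add: apply_diff)
      also have "\<dots> < c * e" using M[OF that] by (simp add: dist_norm)
      finally show ?thesis using c(1) by (simp add: dist_norm)
    qed
    then show "\<exists>M. \<forall>m\<ge>M. \<forall>n\<ge>M. dist (f m) (f n) < e" by blast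
  qed
  then obtain g where g: "f \<longlonglongrightarrow> g"
    using Cauchy_convergent convergent_def by blast
  have "(f n, the (T (f n))) \<in> Map.graph T" for n
    using f[of n] by (auto intro: in_graphI)
  then have "(g, y) \<in> Map.graph T"
    using closed_sequentially[of "Map.graph T" "\<lambda>n. (f n, the (T (f n)))"] tendsto_Pair[OF g lim]
      closed unfolding closed_operator_def by blast
  with g that show ?thesis using in_graphD by metis
qed

lemma closed_ran: "closed (ran T)"
  unfolding closed_sequential_limits
proof (intro allI impI)
  fix y l assume y: "(\<forall>n. y n \<in> ran T) \<and> y \<longlonglongrightarrow> l"
  then have "y n \<in> (\<lambda>f. the (T f)) ` dom T" for n
    unfolding ran_eq_image[symmetric] by blast
  then have "\<exists>f\<in>dom T. the (T f) = y n" for n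
    by (metis (no_types, lifting) imageE)
  then obtain f where f: "\<And>n. f n \<in> dom T" "\<And>n. the (T (f n)) = y n" by metis
  obtain g where "T g = Some l"
    by (rule preimages_converge[of f l]) (use f y in auto)
  then show "l \<in> ran T" by (rule ranI)
qed

lemma has_projections_ran: "has_projections (ran T)"
  by (rule closed_subspace_has_projections[OF subspace_ran closed_ran])

lemma left_semi_fredholm:
  assumes "densely_defined T"
  shows "left_semi_fredholm T"
  using assms linear closed closed_ran cdimension_finite_iff[of "{0}"]
  by (auto simp: left_semi_fredholm_def ker_trivial complex_vector.span_zero simp del: enat_ord_simps)

lemma fredholm:
  assumes "densely_defined T" and defect: "defect_number T 0 < \<infinity>"
  shows "fredholm T"
proof -
  have "cdimension (ker T) < \<infinity>"
    using left_semi_fredholm[OF assms(1)] by (simp add: left_semi_fredholm_def)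
  then show ?thesis
    using assms linear closed closed_ran
    by (simp add: fredholm_def ker_adjoint_operator defect_number_zero plus_eq_infty_iff_enat)
qed

end

text \<open>
  Convergence is pulled back through \<open>A\<close> first and through \<open>B\<close> afterwards; the lower bounds multiply.
\<close>

lemma regular_operator_comp:
  assumes "regular_operator A" "regular_operator B"
  shows "regular_operator (A \<circ>\<^sub>m B)"
proof
  interpret A: regular_operator A by fact
  interpret B: regular_operator B by fact
  have D: "f \<in> dom B" "the (B f) \<in> dom A" if "f \<in> dom (A \<circ>\<^sub>m B)" for f
    using that unfolding dom_comp_eq by blast+
  have "complex_vector.subspace (dom (A \<circ>\<^sub>m B))"
    unfolding complex_vector.subspace_def
  proof (intro conjI ballI allI)
    show "0 \<in> dom (A \<circ>\<^sub>m B)"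
      unfolding dom_comp_eq mem_Collect_eq B.apply_zero
      by (intro conjI complex_vector.subspace_0 A.subspace_dom B.subspace_dom)
    fix f assume f: "f \<in> dom (A \<circ>\<^sub>m B)"
    show "f + g \<in> dom (A \<circ>\<^sub>m B)" if g: "g \<in> dom (A \<circ>\<^sub>m B)" for g
      unfolding dom_comp_eq mem_Collect_eq B.apply_add[OF D(1)[OF f] D(1)[OF g]]
      by (intro conjI complex_vector.subspace_add A.subspace_dom B.subspace_dom D f g)
    show "c *\<^sub>C f \<in> dom (A \<circ>\<^sub>m B)" for c
      unfolding dom_comp_eq mem_Collect_eq B.apply_scale[OF D(1)[OF f]]
      by (intro conjI complex_vector.subspace_scale A.subspace_dom B.subspace_dom D f)
  qed
  then show "linear_operator (A \<circ>\<^sub>m B)"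
    unfolding linear_operator_def
  proof (intro conjI ballI allI)
    fix f assume f: "f \<in> dom (A \<circ>\<^sub>m B)"
    show "the ((A \<circ>\<^sub>m B) (f + g)) = the ((A \<circ>\<^sub>m B) f) + the ((A \<circ>\<^sub>m B) g)"
      if g: "g \<in> dom (A \<circ>\<^sub>m B)" for g
      using complex_vector.subspace_add[OF B.subspace_dom D(1)[OF f] D(1)[OF g]]
      by (simp only: the_comp_eq B.apply_add A.apply_add D[OF f] D[OF g])
    show "the ((A \<circ>\<^sub>m B) (c *\<^sub>C f)) = c *\<^sub>C the ((A \<circ>\<^sub>m B) f)" for c
      using complex_vector.subspace_scale[OF B.subspace_dom D(1)[OF f]]
      by (simp only: the_comp_eq B.apply_scale A.apply_scale D[OF f])
  qed
  show "closed_operator (A \<circ>\<^sub>m B)"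
    unfolding closed_operator_def closed_sequential_limits
  proof safe
    fix p f h
    assume "\<forall>n. p n \<in> Map.graph (A \<circ>\<^sub>m B)" and lim: "p \<longlonglongrightarrow> (f, h)"
    then have "(A \<circ>\<^sub>m B) (fst (p n)) = Some (snd (p n))" for n
      using in_graphD by (metis prod.collapse)
    then have "\<exists>z. B (fst (p n)) = Some z \<and> A z = Some (snd (p n))" for n
      unfolding map_comp_Some_iff by blast
    then have Bp: "fst (p n) \<in> dom B"
      and Ap: "A (the (B (fst (p n)))) = Some (snd (p n))" for n
      by (metis domI, metis option.sel)
    obtain g where g: "(\<lambda>n. the (B (fst (p n)))) \<longlonglongrightarrow> g" "A g = Some h"
    proof (rule A.preimages_converge)
      show "the (B (fst (p n))) \<in> dom A" for n using Ap by blast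
      show "(\<lambda>n. the (A (the (B (fst (p n)))))) \<longlonglongrightarrow> h"
        using tendsto_snd[OF lim] by (simp add: Ap)
    qed
    have "(\<lambda>n. fst (p n)) \<longlonglongrightarrow> f"
      using tendsto_fst[OF lim] by simp
    moreover obtain f' where "(\<lambda>n. fst (p n)) \<longlonglongrightarrow> f'" "B f' = Some g"
      by (rule B.preimages_converge[OF Bp g(1)])
    ultimately have "B f = Some g"
      using LIMSEQ_unique by blast
    with g(2) show "(f, h) \<in> Map.graph (A \<circ>\<^sub>m B)"
      by (intro in_graphI) simp
  qed
  obtain a where a: "a > 0" "\<And>f. f \<in> dom A \<Longrightarrow> a * norm f \<le> norm (the (A f))"
    using A.lower_bound by blast
  obtain b where b: "b > 0" "\<And>f. f \<in> dom B \<Longrightarrow> b * norm f \<le> norm (the (B f))"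
    using B.lower_bound by blast
  have "(a * b) * norm f \<le> norm (the ((A \<circ>\<^sub>m B) f))" if "f \<in> dom (A \<circ>\<^sub>m B)" for f
  proof -
    have f: "f \<in> dom B" "the (B f) \<in> dom A" using that by (simp_all add: dom_comp_eq)
    have "a * (b * norm f) \<le> a * norm (the (B f))"
      using a(1) b(2)[OF f(1)] by (intro mult_left_mono) auto
    also have "\<dots> \<le> norm (the (A (the (B f))))" by (rule a(2)[OF f(2)])
    finally show ?thesis by (simp add: the_comp_eq[OF f(1)] mult.assoc)
  qed
  then show "0 \<in> field_of_regularity (A \<circ>\<^sub>m B)"
    unfolding zero_in_field_of_regularity_iff using a(1) b(1) by (intro exI[of _ "a * b"]) auto
qed


section \<open>Domain and defect of a product\<close>

text \<open>
  It is enough to approximate vectors \<open>f \<in> dom B\<close>. An approximation of \<open>B f\<close> from \<open>dom A \<inter> ran B\<close> is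
  the image of a vector in \<open>dom (A B)\<close>, which is close to \<open>f\<close> by the lower bound of \<open>B\<close>.
\<close>

lemma densely_defined_comp:
  assumes "regular_operator A" "regular_operator B"
    and dense: "densely_defined A" "densely_defined B" and defect: "defect_number B 0 < \<infinity>"
  shows "densely_defined (A \<circ>\<^sub>m B)"
proof -
  interpret A: regular_operator A by fact
  interpret B: regular_operator B by fact
  obtain c where c: "c > 0" "\<And>f. f \<in> dom B \<Longrightarrow> c * norm f \<le> norm (the (B f))"
    using B.lower_bound by blast
  have ran_B: "ran B \<subseteq> closure (dom A \<inter> ran B)"
    using dense(1) defect
    by (intro dense_Int_finite_codimension A.subspace_dom B.has_projections_ran)
      (simp_all add: densely_defined_def defect_number_zero)
  have "dom B \<subseteq> closure (dom (A \<circ>\<^sub>m B))"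
  proof
    fix f assume f: "f \<in> dom B"
    have "\<exists>g\<in>dom (A \<circ>\<^sub>m B). dist g f < e" if e: "e > 0" for e
    proof -
      have "the (B f) \<in> closure (dom A \<inter> ran B)"
        using B.apply_in_ran[OF f] ran_B by blast
      then obtain y where y: "y \<in> dom A" "y \<in> ran B" "dist y (the (B f)) < c * e"
        using c(1) e unfolding closure_approachable by (metis Int_iff mult_pos_pos)
      then obtain g where g: "g \<in> dom B" "y = the (B g)"
        by (auto simp: ran_eq_image)
      have "c * norm (g - f) \<le> norm (the (B (g - f)))"
        by (intro c(2) complex_vector.subspace_diff[OF B.subspace_dom] f g)
      also have "\<dots> < c * e"
        using y(3) by (simp add: B.apply_diff[OF g(1) f] g(2) dist_norm)
      finally have "dist g f < e" using c(1) by (simp add: dist_norm)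
      with g y(1) show ?thesis by (auto simp: dom_comp_eq)
    qed
    then show "f \<in> closure (dom (A \<circ>\<^sub>m B))"
      unfolding closure_approachable by blast
  qed
  then have "closure (dom B) \<subseteq> closure (dom (A \<circ>\<^sub>m B))"
    by (rule closure_minimal) simp
  with dense(2) show ?thesis by (auto simp: densely_defined_def)
qed

text \<open>
  The map \<open>\<phi>\<close> below is the pseudo-inverse of \<open>A\<close> followed by the orthogonal projection onto the
  complement \<open>V\<close> of \<open>ran B\<close>; in the relation \<open>R\<close>, the vector \<open>f\<close> is the value of the pseudo-inverse at
  \<open>g\<close>. If \<open>\<phi> g = 0\<close> for \<open>g\<close> in \<open>W\<close>, then \<open>g = A f\<close> with \<open>f \<in> ran B\<close>, so \<open>g\<close> lies in \<open>ran (A B)\<close>, to which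
  it is orthogonal. The image of \<open>W\<close> is the projection of \<open>dom A\<close> to \<open>V\<close> and hence dense.
\<close>

lemma cdimension_ran_diff_comp:
  assumes "regular_operator A" "regular_operator B" and dense: "densely_defined A"
  shows "cdimension (orthogonal_complement (ran (A \<circ>\<^sub>m B)) \<inter> ran A)
           = cdimension (orthogonal_complement (ran B))"
proof -
  interpret A: regular_operator A by fact
  interpret B: regular_operator B by fact
  interpret AB: regular_operator "A \<circ>\<^sub>m B" by (rule regular_operator_comp) fact+
  define V where "V = orthogonal_complement (ran B)"
  define W where "W = orthogonal_complement (ran (A \<circ>\<^sub>m B)) \<inter> ran A"
  define R where "R g v \<longleftrightarrow> v \<in> V \<and>
      (\<exists>f\<in>dom A. g - the (A f) \<in> orthogonal_complement (ran A) \<and> f - v \<in> ran B)" for g v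
  have sub: "complex_vector.subspace V" "complex_vector.subspace W"
    unfolding V_def W_def
    by (intro complex_vector.subspace_inter subspace_orthogonal_complement A.subspace_ran)+
  have ran_AB: "the (A f) \<in> ran (A \<circ>\<^sub>m B)" if "f \<in> dom A" "f \<in> ran B" for f
  proof -
    obtain g where g: "g \<in> dom B" "f = the (B g)"
      using \<open>f \<in> ran B\<close> unfolding ran_eq_image by blast
    with \<open>f \<in> dom A\<close> have "g \<in> dom (A \<circ>\<^sub>m B)" unfolding dom_comp_eq by blast
    from AB.apply_in_ran[OF this] show ?thesis by (simp only: the_comp_eq[OF g(1)] g(2))
  qed
  obtain \<phi> where lin: "Vector_Spaces.linear scaleC scaleC \<phi>" and \<phi>: "\<And>g v. \<phi> g = v \<longleftrightarrow> R g v"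
  proof (rule linear_of_linear_relation[of R])
    show "\<exists>v. R g v" for g
    proof -
      obtain y where y: "y \<in> ran A" "g - y \<in> orthogonal_complement (ran A)"
        using A.has_projections_ran unfolding has_projections_def by blast
      then obtain f where f: "f \<in> dom A" "y = the (A f)" by (auto simp: ran_eq_image)
      obtain w where w: "w \<in> ran B" "f - w \<in> V"
        using B.has_projections_ran unfolding has_projections_def V_def by blast
      have "R g (f - w)"
        unfolding R_def using y f w by (intro conjI bexI[of _ f]) auto
      then show ?thesis ..
    qed
    show "R (g + g') (v + v')" if R: "R g v" "R g' v'" for g v g' v'
    proof -
      obtain f f' where f: "f \<in> dom A" "g - the (A f) \<in> orthogonal_complement (ran A)" "f - v \<in> ran B"
        and f': "f' \<in> dom A" "g' - the (A f') \<in> orthogonal_complement (ran A)" "f' - v' \<in> ran B"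
        using R unfolding R_def by blast
      have "(g + g') - the (A (f + f')) = (g - the (A f)) + (g' - the (A f'))"
        "(f + f') - (v + v') = (f - v) + (f' - v')"
        using A.apply_add[OF f(1) f'(1)] by simp_all
      then have "f + f' \<in> dom A \<and> (g + g') - the (A (f + f')) \<in> orthogonal_complement (ran A)
          \<and> (f + f') - (v + v') \<in> ran B"
        using f f' by (simp only:) (intro conjI complex_vector.subspace_add A.subspace_dom
            B.subspace_ran subspace_orthogonal_complement)
      moreover have "v + v' \<in> V"
        using R complex_vector.subspace_add[OF sub(1)] by (simp add: R_def)
      ultimately show ?thesis unfolding R_def by blast
    qed
    show "R (c *\<^sub>C g) (c *\<^sub>C v)" if R: "R g v" for c g v
    proof -
      obtain f where f: "f \<in> dom A" "g - the (A f) \<in> orthogonal_complement (ran A)" "f - v \<in> ran B"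
        using R unfolding R_def by blast
      have "c *\<^sub>C g - the (A (c *\<^sub>C f)) = c *\<^sub>C (g - the (A f))" "c *\<^sub>C f - c *\<^sub>C v = c *\<^sub>C (f - v)"
        using A.apply_scale[OF f(1)] by (simp_all add: complex_vector.scale_right_diff_distrib)
      then have "c *\<^sub>C f \<in> dom A \<and> c *\<^sub>C g - the (A (c *\<^sub>C f)) \<in> orthogonal_complement (ran A)
          \<and> c *\<^sub>C f - c *\<^sub>C v \<in> ran B"
        using f by (simp only:) (intro conjI complex_vector.subspace_scale A.subspace_dom
            B.subspace_ran subspace_orthogonal_complement)
      moreover have "c *\<^sub>C v \<in> V"
        using R complex_vector.subspace_scale[OF sub(1)] by (simp add: R_def)
      ultimately show ?thesis unfolding R_def by blast
    qed
    show "v = 0" if R: "R 0 v" for v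
    proof -
      obtain f where f: "f \<in> dom A" "0 - the (A f) \<in> orthogonal_complement (ran A)" "f - v \<in> ran B"
        using R unfolding R_def by blast
      have "0 - the (A f) \<in> ran A"
        using A.apply_in_ran[OF f(1)] complex_vector.subspace_neg[OF A.subspace_ran] by simp
      from orthogonal_to_self_imp_zero[OF this f(2)] have "f \<in> ker A"
        using f(1) by (simp add: ker_def)
      then have "f = 0" using A.ker_trivial by simp
      then have "v \<in> ran B"
        using complex_vector.subspace_neg[OF B.subspace_ran f(3)] by simp
      moreover have "v \<in> orthogonal_complement (ran B)" using R by (simp add: R_def V_def)
      ultimately show ?thesis by (rule orthogonal_to_self_imp_zero)
    qed
  qed blast
  interpret \<phi>: Vector_Spaces.linear scaleC scaleC \<phi> by (rule lin)
  have ker: "g = 0" if g: "g \<in> W" "\<phi> g = 0" for g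
  proof -
    from g(2) have "R g 0" by (simp add: \<phi>)
    then obtain f where f: "f \<in> dom A" "g - the (A f) \<in> orthogonal_complement (ran A)" "f \<in> ran B"
      unfolding R_def diff_0_right by blast
    have "g - the (A f) \<in> ran A"
      using g(1) A.apply_in_ran[OF f(1)] complex_vector.subspace_diff[OF A.subspace_ran]
      by (simp add: W_def)
    from orthogonal_to_self_imp_zero[OF this f(2)] have "g \<in> ran (A \<circ>\<^sub>m B)"
      using ran_AB[OF f(1,3)] by simp
    moreover have "g \<in> orthogonal_complement (ran (A \<circ>\<^sub>m B))" using g(1) by (simp add: W_def)
    ultimately show ?thesis by (rule orthogonal_to_self_imp_zero)
  qed
  have "inj_on \<phi> W"
  proof (rule inj_onI)
    fix g g' assume "g \<in> W" "g' \<in> W" "\<phi> g = \<phi> g'"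
    then have "g - g' = 0"
      using ker[of "g - g'"] complex_vector.subspace_diff[OF sub(2)] by (simp add: \<phi>.diff)
    then show "g = g'" by simp
  qed
  then have "cdimension (\<phi> ` W) = cdimension W"
    by (rule cdimension_injective_image[OF lin sub(2)])
  moreover have "cdimension (\<phi> ` W) = cdimension V"
  proof (rule cdimension_dense_subspace)
    show "complex_vector.subspace (\<phi> ` W)" by (rule \<phi>.subspace_image[OF sub(2)])
    have "R g (\<phi> g)" for g using \<phi> by blast
    then show "\<phi> ` W \<subseteq> V" by (auto simp: R_def)
    \<comment> \<open>The part of \<open>A d\<close> orthogonal to \<open>ran (A B)\<close> is \<open>A h\<close> with \<open>d - h \<in> ran B\<close>, so that \<open>h\<close> and \<open>d\<close>
      have the same projection to \<open>V\<close>.\<close>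
    have image: "q \<in> \<phi> ` W" if q: "q \<in> V" and d: "d \<in> dom A" "d - q \<in> ran B" for d q
    proof -
      obtain y where y: "y \<in> ran (A \<circ>\<^sub>m B)" "the (A d) - y \<in> orthogonal_complement (ran (A \<circ>\<^sub>m B))"
        using AB.has_projections_ran unfolding has_projections_def by blast
      obtain f where AB_f: "f \<in> dom (A \<circ>\<^sub>m B)" "y = the ((A \<circ>\<^sub>m B) f)"
        using y(1) unfolding ran_eq_image by blast
      have f: "f \<in> dom B" "the (B f) \<in> dom A"
        using AB_f(1) unfolding dom_comp_eq by blast+
      have y_eq: "y = the (A (the (B f)))"
        unfolding AB_f(2) by (rule the_comp_eq[OF f(1)])
      define h where "h = d - the (B f)"
      have h: "h \<in> dom A" "the (A h) = the (A d) - y"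
        using complex_vector.subspace_diff[OF A.subspace_dom d(1) f(2)] A.apply_diff[OF d(1) f(2)]
        by (simp_all add: h_def y_eq)
      have "the (A h) \<in> W"
        using y(2) h A.apply_in_ran[OF h(1)] by (simp add: W_def)
      have "h - q = (d - q) - the (B f)" by (simp add: h_def)
      then have "h - q \<in> ran B"
        using complex_vector.subspace_diff[OF B.subspace_ran d(2) B.apply_in_ran[OF f(1)]]
        by (simp only:)
      moreover have "the (A h) - the (A h) \<in> orthogonal_complement (ran A)"
        using complex_vector.subspace_0[OF subspace_orthogonal_complement] by simp
      ultimately have "R (the (A h)) q"
        unfolding R_def using q h(1) by blast
      then have "\<phi> (the (A h)) = q" by (simp only: \<phi>)
      with \<open>the (A h) \<in> W\<close> show ?thesis by blast
    qed
    show "V \<subseteq> closure (\<phi> ` W)"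
    proof
      fix v assume v: "v \<in> V"
      have "\<exists>q\<in>\<phi> ` W. dist q v < e" if e: "e > 0" for e
      proof -
        have "v \<in> closure (dom A)" using dense by (simp add: densely_defined_def)
        then obtain d where d: "d \<in> dom A" "dist d v < e"
          using e unfolding closure_approachable by blast
        obtain r where r: "r \<in> ran B" "d - r \<in> V"
          using B.has_projections_ran unfolding has_projections_def V_def by blast
        have "d - r \<in> \<phi> ` W" using image[OF r(2) d(1)] r(1) by simp
        \<comment> \<open>The projection \<open>d - r\<close> of \<open>d\<close> is at least as close to \<open>v \<in> V\<close> as \<open>d\<close> itself.\<close>
        moreover have "(d - r) - v \<in> V"
          using complex_vector.subspace_diff[OF sub(1) r(2) v] .
        then have "norm ((d - r) - v) \<le> norm (((d - r) - v) + r)"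
          using r(1) by (intro norm_le_norm_add_orthogonal orthogonal_complementD(2)) (auto simp: V_def)
        then have "dist (d - r) v < e"
          using d(2) by (simp add: dist_norm)
        ultimately show ?thesis by blast
      qed
      then show "v \<in> closure (\<phi> ` W)"
        unfolding closure_approachable by blast
    qed
  qed
  ultimately show ?thesis by (simp add: V_def W_def)
qed

text \<open>
  The complement of \<open>ran (A B)\<close> contains that of the larger space \<open>ran A\<close>; what remains inside \<open>ran A\<close>
  has the dimension of the complement of \<open>ran B\<close>.
\<close>

lemma defect_number_comp:
  assumes "regular_operator A" "regular_operator B" and dense: "densely_defined A"
  shows "defect_number (A \<circ>\<^sub>m B) 0 = defect_number A 0 + defect_number B 0"
proof -
  interpret A: regular_operator A by fact
  let ?K = "orthogonal_complement (ran (A \<circ>\<^sub>m B))"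
  let ?P = "orthogonal_complement (ran A)"
  have PK: "?P \<subseteq> ?K"
    by (rule orthogonal_complement_antimono[OF ran_comp_subset])
  have "cdimension ?K = cdimension ?P + cdimension (?K \<inter> ran A)"
  proof (rule cdimension_direct_sum)
    show "?P \<inter> (?K \<inter> ran A) = {0}"
      using Int_orthogonal_complement[OF A.subspace_ran]
        complex_vector.subspace_0[OF subspace_orthogonal_complement[of "ran (A \<circ>\<^sub>m B)"]] by blast
    fix u assume u: "u \<in> ?K"
    obtain a where a: "a \<in> ran A" "u - a \<in> ?P"
      using A.has_projections_ran unfolding has_projections_def by blast
    then have "u - (u - a) \<in> ?K"
      using u PK by (blast intro: complex_vector.subspace_diff[OF subspace_orthogonal_complement])
    then have "a \<in> ?K \<inter> ran A" using a(1) by simp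
    moreover have "u = (u - a) + a" by simp
    ultimately show "\<exists>p\<in>?P. \<exists>w\<in>?K \<inter> ran A. u = p + w" using a(2) by blast
  qed (use PK in \<open>auto intro!: complex_vector.subspace_inter subspace_orthogonal_complement
        A.subspace_ran\<close>)
  then show ?thesis
    using cdimension_ran_diff_comp[OF assms] by (simp add: defect_number_zero)
qed

theorem theorem2p6:
  fixes T1 T2 :: "'a::complex_hilbert_space \<rightharpoonup> 'a"
  assumes separable: "separable_space (euclidean :: 'a topology)"
    and T1: "linear_operator T1" "densely_defined T1" "closed_operator T1"
      "0 \<in> field_of_regularity T1"
    and T2: "linear_operator T2" "densely_defined T2" "closed_operator T2"
      "0 \<in> field_of_regularity T2"
  shows
    "(defect_number T1 0 < \<infinity> \<and> defect_number T2 0 < \<infinity> \<longrightarrow>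
        densely_defined (T1 \<circ>\<^sub>m T2) \<and> closed_operator (T1 \<circ>\<^sub>m T2) \<and>
        densely_defined (T2 \<circ>\<^sub>m T1) \<and> closed_operator (T2 \<circ>\<^sub>m T1) \<and>
        fredholm T1 \<and> fredholm T2 \<and> fredholm (T1 \<circ>\<^sub>m T2) \<and> fredholm (T2 \<circ>\<^sub>m T1) \<and>
        0 \<in> field_of_regularity (T1 \<circ>\<^sub>m T2) \<inter> field_of_regularity (T2 \<circ>\<^sub>m T1) \<and>
        defect_number (T1 \<circ>\<^sub>m T2) 0 = defect_number T1 0 + defect_number T2 0 \<and>
        defect_number T1 0 + defect_number T2 0 = defect_number (T2 \<circ>\<^sub>m T1) 0 \<and>
        defect_number (T2 \<circ>\<^sub>m T1) 0 < \<infinity>) \<and>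
     (densely_defined (T1 \<circ>\<^sub>m T2) \<longrightarrow>
        closed_operator (T1 \<circ>\<^sub>m T2) \<and>
        left_semi_fredholm T1 \<and> left_semi_fredholm T2 \<and> left_semi_fredholm (T1 \<circ>\<^sub>m T2) \<and>
        0 \<in> field_of_regularity (T1 \<circ>\<^sub>m T2) \<and>
        defect_number (T1 \<circ>\<^sub>m T2) 0 = defect_number T1 0 + defect_number T2 0)"
proof -
  interpret T1: regular_operator T1 by unfold_locales (fact T1)+
  interpret T2: regular_operator T2 by unfold_locales (fact T2)+
  have r: "regular_operator T1" "regular_operator T2" by unfold_locales
  interpret T12: regular_operator "T1 \<circ>\<^sub>m T2" by (rule regular_operator_comp[OF r])
  interpret T21: regular_operator "T2 \<circ>\<^sub>m T1" by (rule regular_operator_comp[OF r(2,1)])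
  have defect12: "defect_number (T1 \<circ>\<^sub>m T2) 0 = defect_number T1 0 + defect_number T2 0"
    by (rule defect_number_comp[OF r T1(2)])
  have defect21: "defect_number (T2 \<circ>\<^sub>m T1) 0 = defect_number T1 0 + defect_number T2 0"
    using defect_number_comp[OF r(2,1) T2(2)] by (simp add: add.commute)
  show ?thesis
  proof (intro conjI impI)
    assume fin: "defect_number T1 0 < \<infinity> \<and> defect_number T2 0 < \<infinity>"
    show dense12: "densely_defined (T1 \<circ>\<^sub>m T2)"
      using densely_defined_comp[OF r T1(2) T2(2)] fin by blast
    show dense21: "densely_defined (T2 \<circ>\<^sub>m T1)"
      using densely_defined_comp[OF r(2,1) T2(2) T1(2)] fin by blast
    have sum: "defect_number T1 0 + defect_number T2 0 < \<infinity>"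
      using fin by (simp add: plus_eq_infty_iff_enat)
    then show "defect_number (T2 \<circ>\<^sub>m T1) 0 < \<infinity>" by (simp only: defect21)
    show "fredholm T1" "fredholm T2" using T1.fredholm T2.fredholm T1(2) T2(2) fin by blast+
    show "fredholm (T1 \<circ>\<^sub>m T2)" using T12.fredholm[OF dense12] sum by (simp only: defect12)
    show "fredholm (T2 \<circ>\<^sub>m T1)" using T21.fredholm[OF dense21] sum by (simp only: defect21)
  qed (blast intro: T12.closed T21.closed T12.regular T21.regular T1.left_semi_fredholm
      T2.left_semi_fredholm T12.left_semi_fredholm T1(2) T2(2) defect12 defect21[symmetric])+
qed

end
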